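(* Let $k\ge 2$ be an integer. For every $k$-ary tree $T$, there is a canonically labelled graph $G$ such that $T\simeq\mathsf{TS}_{k+1}(G)$.
   Context: Graphs are finite, simple, undirected and vertex-labelled; $\simeq$ denotes isomorphism. For a graph $G$ and an integer $m\ge 2$, $\mathsf{TS}_m(G)$ is the graph whose nodes are all size-$m$ independent sets of $G$, two nodes $I,J$ being adjacent if there are vertices $u,v$ of $G$ with $I\setminus J=\{u\}$, $J\setminus I=\{v\}$ and $uv\in E(G)$; each node is labelled by its independent set. A $k$-ary tree is a rooted tree in which each node has at most $k$ children. Let $I_{k+1}=\{a_1,\dots,a_{k+1}\}$ and let $b_1,\dots,b_k$ be further distinct labels. If $k\ge 2$ and $T:=\mathsf{TS}_{k+1}(G)$ is a ($k$-ary, rooted) tree, then $G$ and $T$ are called canonically labelled if: (a) the root of $T$ is labelled $I_{k+1}$; (b) the $d\le k$ children of the root are labelled $(I_{k+1}\setminus\{a_i\})\cup\{b_i\}$, $i=1,\dots,d$; (c) the labels $b_j$, $j=d+1,\dots,k$ (if any) are not used; (d) every other node of $T$ has a label $S$ with $|I_{k+1}\cap S|\le k-1$. *)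

theory Defs
  imports "Graph_Theory.Graph_Theory"
begin

text \<open>
  A finite simple undirected graph is a \<^locale>\<open>pair_graph\<close>: a finite, loop-free and
  symmetric set of arcs, the edge \<open>uv\<close> being the two arcs \<open>(u,v)\<close> and \<open>(v,u)\<close>.
\<close>

definition independent_set :: "'v pair_pre_digraph \<Rightarrow> 'v set \<Rightarrow> bool" where
  "independent_set G S \<longleftrightarrow> S \<subseteq> pverts G \<and> (\<forall>u\<in>S. \<forall>v\<in>S. (u, v) \<notin> parcs G)"

definition independent_sets_of_size :: "nat \<Rightarrow> 'v pair_pre_digraph \<Rightarrow> 'v set set" where
  "independent_sets_of_size m G = {S. independent_set G S \<and> finite S \<and> card S = m}"

definition TS :: "nat \<Rightarrow> 'v pair_pre_digraph \<Rightarrow> 'v set pair_pre_digraph" where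
  "TS m G =
    \<lparr> pverts = independent_sets_of_size m G,
      parcs = {(I, J). I \<in> independent_sets_of_size m G \<and> J \<in> independent_sets_of_size m G \<and>
        (\<exists>u v. I - J = {u} \<and> J - I = {v} \<and> (u, v) \<in> parcs G)} \<rparr>"

text \<open>
  The library's \<^const>\<open>forest\<close> and \<^const>\<open>tree\<close> are not suitable here: a pair of opposite arcs is
  a directed cycle of length 2. Directed cycles of length at least 3 in a symmetric loop-free
  digraph are exactly the (oriented) cycles of the undirected graph.
\<close>

definition undirected_tree :: "'a pair_pre_digraph \<Rightarrow> bool" where
  "undirected_tree T \<longleftrightarrow> pair_graph T \<and> Digraph_Component.connected (with_proj T) \<and>
     \<not> (\<exists>p. pre_digraph.cycle (with_proj T) p \<and> 3 \<le> length p)"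

text \<open>\<open>w\<close> is a child of \<open>v\<close> if \<open>v\<close> is the last node before \<open>w\<close> on the path from the root to \<open>w\<close>.\<close>

definition children :: "'a pair_pre_digraph \<Rightarrow> 'a \<Rightarrow> 'a \<Rightarrow> 'a set" where
  "children T r v = {w. \<exists>p. pre_digraph.apath (with_proj T) r (p @ [(v, w)]) w}"

definition kary_tree :: "nat \<Rightarrow> 'a pair_pre_digraph \<Rightarrow> 'a \<Rightarrow> bool" where
  "kary_tree k T r \<longleftrightarrow> undirected_tree T \<and> r \<in> pverts T \<and>
     (\<forall>v\<in>pverts T. card (children T r v) \<le> k)"

definition rooted_isomorphic ::
    "'a pair_pre_digraph \<Rightarrow> 'a \<Rightarrow> 'b pair_pre_digraph \<Rightarrow> 'b \<Rightarrow> bool" where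
  "rooted_isomorphic T r T' r' \<longleftrightarrow>
     (\<exists>hom. pre_digraph.digraph_isomorphism (with_proj T) hom \<and>
        with_proj T' = app_iso hom (with_proj T) \<and> iso_verts hom r = r')"

text \<open>
  Labels are the vertices themselves, so a node of \<^term>\<open>TS (k + 1) G\<close> is its own label.
  A label \<open>b j\<close> that is not used is not a vertex of \<open>G\<close>, and then in no node of
  \<^term>\<open>TS (k + 1) G\<close> either.
\<close>

definition canonically_labelled ::
    "nat \<Rightarrow> (nat \<Rightarrow> 'v) \<Rightarrow> (nat \<Rightarrow> 'v) \<Rightarrow> 'v pair_pre_digraph \<Rightarrow> bool" where
  "canonically_labelled k a b G \<longleftrightarrow> pair_graph G \<and>
     (let T = TS (k + 1) G; I = a ` {1..k + 1} in
       kary_tree k T I \<and>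
       (\<exists>d\<le>k. children T I I = (\<lambda>i. (I - {a i}) \<union> {b i}) ` {1..d} \<and>
          (\<forall>j\<in>{d + 1..k}. b j \<notin> pverts G)) \<and>
       (\<forall>S\<in>pverts T. S \<noteq> I \<and> S \<notin> children T I I \<longrightarrow> card (I \<inter> S) \<le> k - 1))"

end

theory Submission
  imports Defs
begin

text \<open>
  The root is labelled \<open>I = {a 1, \<dots>, a (k + 1)}\<close>, and from a node to a child one token slides to a
  fresh vertex. The children of one node move different tokens, and never the token that arrived
  last; as \<open>k\<close> tokens are then available, this is possible for every \<open>k\<close>-ary tree. Let two vertices
  be adjacent iff no label contains both. The labels are then exactly the independent sets of size
  \<open>k + 1\<close>: in such a set take the vertex whose birth node (where it first appears on the way
  from the root) is deepest; the birth nodes of the other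
  vertices are ancestors of it, so all of them still lie in its label. Labels of nodes that are not
  adjacent in the tree share at most \<open>k - 1\<close> vertices: two tokens on the label of the last common
  ancestor have moved away on the path between the nodes and are not on both labels.
\<close>

section \<open>Rooted trees given by a parent function\<close>

text \<open>\<open>depth\<close> drops by one along \<open>par\<close>, which forces every chain of
  parents to end in \<open>r\<close>. The values \<open>par r\<close> and \<open>depth r\<close> are
  left open.\<close>

locale parent_tree =
  fixes V :: "'a set" and r :: 'a and par :: "'a \<Rightarrow> 'a" and depth :: "'a \<Rightarrow> nat"
  assumes root_in: "r \<in> V"
    and par_in: "\<lbrakk>v \<in> V; v \<noteq> r\<rbrakk> \<Longrightarrow> par v \<in> V"
    and depth_par: "\<lbrakk>v \<in> V; v \<noteq> r\<rbrakk> \<Longrightarrow> depth v = Suc (depth (par v))"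
begin

inductive anc :: "'a \<Rightarrow> 'a \<Rightarrow> bool" for u where
  refl: "u \<in> V \<Longrightarrow> anc u u"
| step: "\<lbrakk>anc u (par w); w \<in> V; w \<noteq> r\<rbrakk> \<Longrightarrow> anc u w"

definition tree_arcs :: "('a \<times> 'a) set" where
  "tree_arcs = {(par w, w) |w. w \<in> V - {r}} \<union> {(w, par w) |w. w \<in> V - {r}}"

definition kids :: "'a \<Rightarrow> 'a set" where
  "kids v = {w \<in> V. w \<noteq> r \<and> par w = v}"

lemma node_induct [consumes 1, case_names root child]:
  assumes "v \<in> V" and "P r"
    and "\<And>v. \<lbrakk>v \<in> V; v \<noteq> r; P (par v)\<rbrakk> \<Longrightarrow> P v"
  shows "P v"
  using \<open>v \<in> V\<close>
proof (induction "depth v" arbitrary: v rule: less_induct)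
  case less
  then show ?case
    using assms(2,3) par_in depth_par by (cases "v = r") auto
qed

lemma anc_in: "anc u w \<Longrightarrow> u \<in> V" "anc u w \<Longrightarrow> w \<in> V"
  by (induction rule: anc.induct) auto

lemma anc_trans: "anc v w \<Longrightarrow> anc u v \<Longrightarrow> anc u w"
  by (induction rule: anc.induct) (auto simp: anc.step)

lemma anc_par: "\<lbrakk>w \<in> V; w \<noteq> r\<rbrakk> \<Longrightarrow> anc (par w) w"
  by (simp add: anc.refl anc.step par_in)

lemma anc_root: "v \<in> V \<Longrightarrow> anc r v"
  by (induction rule: node_induct) (simp_all add: anc.refl anc.step root_in)

lemma anc_depth: "anc u w \<Longrightarrow> u = w \<or> depth u < depth w"
  by (induction rule: anc.induct) (auto simp: depth_par)

lemma anc_antisym: "anc u w \<Longrightarrow> anc w u \<Longrightarrow> u = w"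
  using anc_depth[of u w] anc_depth[of w u] by auto

lemma not_anc_par: "\<lbrakk>w \<in> V; w \<noteq> r\<rbrakk> \<Longrightarrow> \<not> anc w (par w)"
  using anc_depth[of w "par w"] depth_par[of w] by auto

lemma anc_cases:
  assumes "anc u w"
  obtains "u = w" | "w \<noteq> r" "anc u (par w)"
  using assms by (cases rule: anc.cases) auto

lemma anc_linear:
  assumes "anc u w" "anc v w"
  shows "anc u v \<or> anc v u"
  using assms
proof (induction rule: anc.induct)
  case (step w)
  show ?case
    using step.prems
  proof (rule anc_cases)
    assume "v = w"
    then show ?thesis using anc.step[OF step.hyps] by simp
  next
    assume "anc v (par w)"
    then show ?thesis by (rule step.IH)
  qed
qed auto

text \<open>Supplies the first node on the way down from \<open>u\<close> to \<open>w\<close>; the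
  token moved there is lost to every label further down.\<close>

lemma anc_first_step:
  assumes "anc u w" "u \<noteq> w"
  obtains c where "c \<in> V" "c \<noteq> r" "par c = u" "anc c w"
proof -
  have "\<exists>c. c \<in> V \<and> c \<noteq> r \<and> par c = u \<and> anc c w"
    using assms
  proof (induction rule: anc.induct)
    case (step w)
    then show ?case
      by (cases "u = par w") (use anc.refl anc.step in blast)+
  qed auto
  with that show thesis by blast
qed

text \<open>In the third case \<open>par c\<close> is the last common ancestor. If
  \<open>par v\<close> lies below \<open>w\<close> or on another branch, so does \<open>v\<close>.
  If \<open>par v\<close> is a proper ancestor of \<open>w\<close>, then \<open>v\<close> and the
  first step from \<open>par v\<close> towards \<open>w\<close> are equal or siblings.\<close>

lemma anc_or_branch:
  assumes "v \<in> V" "w \<in> V"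
  obtains "anc v w" | "anc w v"
  | c c' where "c \<in> V" "c \<noteq> r" "c' \<in> V" "c' \<noteq> r" "par c = par c'" "c \<noteq> c'"
      "anc c v" "anc c' w"
proof -
  have "anc v w \<or> anc w v \<or> (\<exists>c c'. c \<in> V \<and> c \<noteq> r \<and> c' \<in> V \<and> c' \<noteq> r \<and>
    par c = par c' \<and> c \<noteq> c' \<and> anc c v \<and> anc c' w)"
    using assms(1)
  proof (induction rule: node_induct)
    case root
    show ?case using anc_root[OF assms(2)] by blast
  next
    case (child v)
    from child.IH consider "anc (par v) w" | "anc w (par v)"
      | c c' where "c \<in> V" "c \<noteq> r" "c' \<in> V" "c' \<noteq> r" "par c = par c'" "c \<noteq> c'"
          "anc c (par v)" "anc c' w" by blast
    then show ?case
    proof cases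
      case 1
      show ?thesis
      proof (cases "par v = w")
        case True
        then show ?thesis using anc_par child.hyps by auto
      next
        case False
        with 1 obtain c where "c \<in> V" "c \<noteq> r" "par c = par v" "anc c w"
          by (rule anc_first_step)
        then show ?thesis using child.hyps anc.refl by metis
      qed
    next
      case 2
      then show ?thesis using child.hyps anc.step by blast
    next
      case 3
      then show ?thesis using child.hyps anc.step by metis
    qed
  qed
  with that show thesis by blast
qed

end

section \<open>Labelling the nodes by token configurations\<close>

text \<open>
  Going from a node to its child \<open>w\<close>, the token on \<open>m w\<close> slides to the new vertex \<open>x w\<close>.
\<close>

locale token_tree = parent_tree +
  fixes I :: "'v set" and L :: "'a \<Rightarrow> 'v set" and m x :: "'a \<Rightarrow> 'v"
  assumes finite_V: "finite V" and finite_I: "finite I"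
    and label_root: "L r = I"
    and label_child: "\<lbrakk>w \<in> V; w \<noteq> r\<rbrakk> \<Longrightarrow> L w = insert (x w) (L (par w) - {m w})"
    and moved_in: "\<lbrakk>w \<in> V; w \<noteq> r\<rbrakk> \<Longrightarrow> m w \<in> L (par w)"
    and moved_not_new: "\<lbrakk>w \<in> V; w \<noteq> r; par w \<noteq> r\<rbrakk> \<Longrightarrow> m w \<noteq> x (par w)"
    and moved_inj: "\<lbrakk>v \<in> V; v \<noteq> r; w \<in> V; w \<noteq> r; par v = par w; m v = m w\<rbrakk> \<Longrightarrow> v = w"
    and new_inj: "inj_on x (V - {r})"
    and new_not_root: "\<lbrakk>w \<in> V; w \<noteq> r\<rbrakk> \<Longrightarrow> x w \<notin> I"
begin

lemma new_in: "\<lbrakk>w \<in> V; w \<noteq> r\<rbrakk> \<Longrightarrow> x w \<in> L w"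
  by (simp add: label_child)

text \<open>Since \<open>x\<close> is injective and avoids \<open>I\<close>, the vertex
  \<open>x v\<close> can enter a label only at \<open>v\<close> and is then merely inherited
  downwards.\<close>

lemma new_in_label:
  assumes "w \<in> V" "v \<in> V" "v \<noteq> r" "x v \<in> L w"
  shows "anc v w"
  using assms(1,4)
proof (induction rule: node_induct)
  case root
  then show ?case using new_not_root assms label_root by auto
next
  case (child w)
  then consider "x v = x w" | "x v \<in> L (par w)" by (auto simp: label_child)
  then show ?case
  proof cases
    case 1
    with new_inj assms child.hyps have "v = w" by (auto dest: inj_onD)
    with assms show ?thesis by (auto intro: anc.refl)
  next
    case 2
    with child show ?thesis by (simp add: anc.step)
  qed
qed

text \<open>A relation, because a vertex on no label has no birth node. For the others the node is
  unique, as \<open>x\<close> is injective and avoids \<open>I\<close>.\<close>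

definition birth :: "'v \<Rightarrow> 'a \<Rightarrow> bool" where
  "birth p v \<longleftrightarrow> v \<in> V \<and> p \<in> L v \<and> (if v = r then p \<in> I else p = x v)"

lemma birth_ex:
  assumes "w \<in> V" "p \<in> L w"
  shows "\<exists>v. birth p v"
  using assms
proof (induction rule: node_induct)
  case root
  then show ?case using root_in label_root by (auto simp: birth_def)
next
  case (child w)
  show ?case
  proof (cases "p = x w")
    case True
    then have "birth p w" using child.hyps new_in by (simp add: birth_def)
    then show ?thesis ..
  next
    case False
    then show ?thesis using child label_child[of w] by blast
  qed
qed

lemma birth_anc: "\<lbrakk>birth p v; w \<in> V; p \<in> L w\<rbrakk> \<Longrightarrow> anc v w"
  using new_in_label anc_root by (auto simp: birth_def split: if_splits)

text \<open>Climbing from \<open>w\<close> to \<open>u\<close>, the vertex \<open>p\<close> could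
  disappear only above a node where it is new. As \<open>p\<close> is already on \<open>L v\<close>,
  that node would be an ancestor of \<open>v\<close>, and hence of its own parent.\<close>

lemma label_between:
  assumes "birth p v" "anc u w" "anc v u" "p \<in> L w"
  shows "p \<in> L u"
  using assms(2,3,4)
proof (induction rule: anc.induct)
  case (step w)
  then consider "p = x w" | "p \<in> L (par w)" by (auto simp: label_child)
  then show ?case
  proof cases
    case 1
    have "p \<in> L v" "v \<in> V" using assms(1) by (auto simp: birth_def)
    then have "anc w v" using 1 step.hyps new_in_label by blast
    then have "anc w (par w)" using step anc_trans by blast
    with step.hyps not_anc_par show ?thesis by blast
  next
    case 2
    with step show ?thesis by blast
  qed
qed

text \<open>A vertex that has been left is never entered again: were \<open>m w = x v\<close> for
  some \<open>v\<close> below \<open>w\<close>, then \<open>m w \<in> L (par w)\<close> would place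
  \<open>v\<close>, and with it \<open>w\<close>, above \<open>par w\<close>.\<close>

lemma moved_not_in_label:
  assumes "anc w w'" "w \<noteq> r"
  shows "m w \<notin> L w'"
proof -
  have "w \<in> V" using assms anc_in by blast
  with assms(2) have m: "m w \<in> L (par w)" "par w \<in> V" using moved_in par_in by auto
  have new: "m w \<noteq> x v" if "anc w v" "v \<noteq> r" for v
  proof
    assume "m w = x v"
    then have "anc v (par w)"
      using m that new_in_label anc_in by metis
    then have "anc w (par w)" using that anc_trans by blast
    then show False using not_anc_par \<open>w \<in> V\<close> assms(2) by blast
  qed
  show ?thesis
    using assms(1)
  proof (induction rule: anc.induct)
    case refl
    have "m w \<noteq> x w" using new anc.refl \<open>w \<in> V\<close> assms(2) by blast
    then show ?case using label_child refl assms(2) by auto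
  next
    case (step w')
    then have "m w \<noteq> x w'" using new anc.step by blast
    with step show ?case by (simp add: label_child)
  qed
qed

lemma label_finite: "w \<in> V \<Longrightarrow> finite (L w)"
proof (induction rule: node_induct)
  case (child w)
  then show ?case using label_child[of w] by simp
qed (simp add: label_root finite_I)

lemma label_card:
  assumes "w \<in> V"
  shows "card (L w) = card I"
  using assms
proof (induction rule: node_induct)
  case root
  then show ?case by (simp add: label_root)
next
  case (child w)
  have "x w \<notin> L (par w)"
    using child.hyps new_in_label not_anc_par par_in by blast
  moreover have "finite (L (par w))" using child.hyps label_finite par_in by blast
  ultimately have "card (L w) = Suc (card (L (par w) - {m w}))"
    using child.hyps label_child[of w] by simp
  also have "\<dots> = card (L (par w))"
    using \<open>finite (L (par w))\<close> moved_in[OF child.hyps] by (rule card_Suc_Diff1)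
  finally show ?case using child.IH by simp
qed

text \<open>The new vertex of each node lies on the label of the other, so each is an ancestor of
  the other.\<close>

lemma label_inj: "inj_on L V"
proof (rule inj_onI)
  fix v w assume *: "v \<in> V" "w \<in> V" "L v = L w"
  have "anc v w" if "v \<in> V" "w \<in> V" "L v = L w" for v w
    using that new_in new_in_label anc_root by (cases "v = r") auto
  with * show "v = w" by (metis anc_antisym)
qed

lemma label_union: "(\<Union>v\<in>V. L v) \<subseteq> I \<union> x ` (V - {r})"
proof -
  have "L v \<subseteq> I \<union> x ` (V - {r})" if "v \<in> V" for v
    using that
  proof (induction rule: node_induct)
    case (child v)
    then show ?case using label_child[of v] by auto
  qed (simp add: label_root)
  then show ?thesis by blast
qed

text \<open>Take the first two steps \<open>c\<close> and \<open>e\<close> from \<open>u\<close>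
  towards \<open>w\<close>. The token \<open>m e\<close> differs from the newcomer
  \<open>x c\<close>, so it was already on \<open>L u\<close>; neither \<open>m c\<close> nor
  \<open>m e\<close> comes back.\<close>

lemma two_tokens_moved:
  assumes "anc u w" "u \<noteq> w" "par w \<noteq> u"
  obtains p q where "p \<noteq> q" "p \<in> L u - L w" "q \<in> L u - L w"
proof -
  obtain c where c: "c \<in> V" "c \<noteq> r" "par c = u" "anc c w"
    using assms(1,2) by (rule anc_first_step)
  moreover have "c \<noteq> w" using c assms(3) by blast
  ultimately obtain e where e: "e \<in> V" "e \<noteq> r" "par e = c" "anc e w"
    using anc_first_step by metis
  have "m c \<in> L u" "m c \<notin> L w"
    using c moved_in moved_not_in_label by auto
  moreover have "m e \<in> L c" "m e \<notin> L w" "m e \<noteq> x c"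
    using c e moved_in moved_not_in_label moved_not_new by auto
  moreover have "L c = insert (x c) (L u - {m c})" using c label_child by auto
  ultimately show thesis using that[of "m c" "m e"] by auto
qed

section \<open>The graph whose non-edges are the pairs on a common label\<close>

definition token_graph :: "'v pair_pre_digraph" where
  "token_graph =
    \<lparr> pverts = (\<Union>v\<in>V. L v),
      parcs = {(p, q). p \<in> (\<Union>v\<in>V. L v) \<and> q \<in> (\<Union>v\<in>V. L v) \<and> p \<noteq> q \<and>
        (\<forall>v\<in>V. \<not> {p, q} \<subseteq> L v)} \<rparr>"

lemma pair_graph_token_graph: "pair_graph token_graph"
proof -
  have "finite (pverts token_graph)"
    using finite_V label_finite by (auto simp: token_graph_def)
  moreover have "parcs token_graph \<subseteq> pverts token_graph \<times> pverts token_graph"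
    by (auto simp: token_graph_def)
  ultimately have "finite (parcs token_graph)"
    by (meson finite_SigmaI finite_subset)
  with \<open>finite (pverts token_graph)\<close> show ?thesis
    by unfold_locales (auto simp: token_graph_def symmetric_def sym_def)
qed

text \<open>This is the Helly property of subtrees: the nodes whose labels contain \<open>p\<close>
  form a subtree rooted at the birth node of \<open>p\<close>, and two distinct vertices of the
  graph are non-adjacent iff their subtrees meet.\<close>

lemma independent_in_label:
  assumes "independent_set token_graph S" "S \<noteq> {}" "finite S"
  shows "\<exists>v\<in>V. S \<subseteq> L v"
proof -
  have verts: "\<exists>v\<in>V. p \<in> L v" if "p \<in> S" for p
    using assms(1) that by (auto simp: independent_set_def token_graph_def)
  have pairs: "\<exists>v\<in>V. p \<in> L v \<and> q \<in> L v" if "p \<in> S" "q \<in> S" for p q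
  proof (cases "p = q")
    case False
    have "(p, q) \<notin> parcs token_graph" using assms(1) that by (auto simp: independent_set_def)
    then show ?thesis using False verts[OF that(1)] verts[OF that(2)] by (simp add: token_graph_def)
  qed (use verts that in blast)
  obtain \<beta> where \<beta>: "birth p (\<beta> p)" if "p \<in> S" for p
  proof -
    have "\<forall>p. \<exists>v. p \<in> S \<longrightarrow> birth p v" using birth_ex verts by blast
    then show thesis using that by metis
  qed
  obtain p where p: "p \<in> S" "\<And>q. q \<in> S \<Longrightarrow> depth (\<beta> q) \<le> depth (\<beta> p)"
  proof -
    let ?D = "(\<lambda>p. depth (\<beta> p)) ` S"
    have "Max ?D \<in> ?D" using assms(2,3) by simp
    then obtain p where "p \<in> S" "Max ?D = depth (\<beta> p)" by blast
    moreover have "depth (\<beta> q) \<le> Max ?D" if "q \<in> S" for q using assms(3) that by simp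
    ultimately show thesis using that by simp
  qed
  have "q \<in> L (\<beta> p)" if "q \<in> S" for q
  proof -
    obtain w where w: "w \<in> V" "p \<in> L w" "q \<in> L w" using pairs p(1) \<open>q \<in> S\<close> by blast
    then have anc: "anc (\<beta> p) w" "anc (\<beta> q) w"
      using birth_anc \<beta> p(1) \<open>q \<in> S\<close> by blast+
    then have "anc (\<beta> q) (\<beta> p)"
      using anc_linear[OF anc] anc_depth[of "\<beta> p" "\<beta> q"] p(2)[OF \<open>q \<in> S\<close>]
      by (auto dest: leD)
    then show ?thesis using label_between \<beta> \<open>q \<in> S\<close> anc w by blast
  qed
  moreover have "\<beta> p \<in> V" using \<beta> p(1) by (auto simp: birth_def)
  ultimately show ?thesis by blast
qed

text \<open>An independent set inside a label of the same size is that label. The size must be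
  positive because a nonempty set is required to find a deepest birth node.\<close>

lemma independent_sets_token_graph:
  assumes "card I \<noteq> 0"
  shows "independent_sets_of_size (card I) token_graph = L ` V"
proof (intro equalityI subsetI)
  fix S assume "S \<in> independent_sets_of_size (card I) token_graph"
  then have S: "independent_set token_graph S" "finite S" "card S = card I"
    by (auto simp: independent_sets_of_size_def)
  moreover have "S \<noteq> {}" using S assms by auto
  ultimately obtain v where "v \<in> V" "S \<subseteq> L v" using independent_in_label by blast
  with S show "S \<in> L ` V"
    using card_subset_eq label_card label_finite by (metis imageI)
next
  fix S assume "S \<in> L ` V"
  then show "S \<in> independent_sets_of_size (card I) token_graph"
    using label_card label_finite
    by (auto simp: independent_sets_of_size_def independent_set_def token_graph_def)
qed

lemma label_child_slide:
  assumes "w \<in> V" "w \<noteq> r"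
  shows "L (par w) - L w = {m w}" "L w - L (par w) = {x w}" "(m w, x w) \<in> parcs token_graph"
proof -
  have new: "x w \<notin> L (par w)" using assms new_in_label not_anc_par par_in by blast
  then show "L (par w) - L w = {m w}" "L w - L (par w) = {x w}"
    using assms label_child[of w] moved_in[of w] by auto
  \<comment> \<open>Where \<open>x w\<close> is present the node is below \<open>w\<close>, and
    there \<open>m w\<close> is gone.\<close>
  have "\<not> {m w, x w} \<subseteq> L v" if "v \<in> V" for v
    using new_in_label[of v w] moved_not_in_label[of w v] assms that by auto
  moreover have "m w \<noteq> x w" using new assms moved_in by metis
  moreover have "m w \<in> L (par w)" "par w \<in> V" "x w \<in> L w"
    using assms moved_in new_in par_in by auto
  ultimately show "(m w, x w) \<in> parcs token_graph"
    using assms by (auto simp: token_graph_def)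
qed

lemma label_slide_anc:
  assumes "anc v w" "L v - L w = {p}" "L w - L v = {q}"
  shows "w \<noteq> r" "par w = v"
proof -
  have "v \<noteq> w" using assms(2) by auto
  then show "par w = v" using two_tokens_moved[OF assms(1)] assms(2) by (metis singletonD)
  show "w \<noteq> r" using \<open>v \<noteq> w\<close> assms(1) anc_root anc_antisym anc_in by blast
qed

lemma siblings_disjoint:
  assumes "c \<in> V" "c \<noteq> r" "c' \<in> V" "c' \<noteq> r" "par c = par c'" "c \<noteq> c'" "anc c z" "anc c' z"
  shows False
proof -
  have "\<not> anc v w" if "v \<in> V" "v \<noteq> r" "par v = par w" "v \<noteq> w" for v w
  proof
    assume "anc v w"
    then have "anc v (par w)" using \<open>v \<noteq> w\<close> by (rule_tac anc_cases) auto
    then show False using not_anc_par[of v] that by simp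
  qed
  then have "\<not> anc c c'" "\<not> anc c' c" using assms by auto
  then show False using anc_linear assms by blast
qed

text \<open>At the last common ancestor the branches start by moving two different tokens. The two
  labels therefore share at most \<open>card I - 2\<close> vertices, whereas a slide leaves
  \<open>card I - 1\<close> in common.\<close>

lemma no_slide_between_branches:
  assumes c: "c \<in> V" "c \<noteq> r" "anc c v" and c': "c' \<in> V" "c' \<noteq> r" "anc c' w"
    and par: "par c = par c'" "c \<noteq> c'"
    and slide: "L v - L w = {p}"
  shows False
proof -
  let ?y = "par c"
  have V: "v \<in> V" "w \<in> V" "?y \<in> V" using c c' anc_in par_in by blast+
  have y: "anc ?y v" "anc ?y w" using anc_trans anc_par c c' par by metis+
  have common: "L v \<inter> L w \<subseteq> L ?y - {m c, m c'}"
  proof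
    fix s assume s: "s \<in> L v \<inter> L w"
    then obtain b where b: "birth s b" using birth_ex V by blast
    then have b_anc: "anc b v" "anc b w" using birth_anc s V by auto
    \<comment> \<open>The birth node of a common vertex is above both \<open>v\<close> and
      \<open>w\<close>, so it cannot lie below \<open>c\<close> or \<open>c'\<close>. Being
      comparable with \<open>c\<close>, it is a proper ancestor of \<open>c\<close>.\<close>
    have "anc b ?y"
    proof (rule ccontr)
      assume n: "\<not> anc b ?y"
      have nc: "\<not> anc c b" "\<not> anc c' b"
        using siblings_disjoint anc_trans b_anc c c' par by metis+
      show False
        using anc_linear[OF b_anc(1) c(3)] anc_cases[of b c] n nc by metis
    qed
    then have "s \<in> L ?y" using label_between b y s by blast
    moreover have "s \<noteq> m c" "s \<noteq> m c'"
      using moved_not_in_label c c' s by blast+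
    ultimately show "s \<in> L ?y - {m c, m c'}" by blast
  qed
  have "m c \<in> L ?y" "m c' \<in> L ?y" "m c \<noteq> m c'"
    using moved_in moved_inj c c' par by metis+
  then have "card (L ?y - {m c, m c'}) = card (L ?y) - 2"
    using label_finite V by (simp add: card_Diff_subset)
  \<comment> \<open>Guards against truncated subtraction: for size one, \<open>n - 1\<close> and
    \<open>n - 2\<close> would coincide.\<close>
  moreover have "card (L ?y) \<ge> 2"
    using \<open>m c \<in> L ?y\<close> \<open>m c' \<in> L ?y\<close> \<open>m c \<noteq> m c'\<close> label_finite[OF V(3)]
    by (metis card_2_iff card_mono empty_subsetI insert_subset)
  moreover have "card (L v \<inter> L w) \<le> card (L ?y - {m c, m c'})"
    using common label_finite V by (simp add: card_mono)
  moreover have "card (L v \<inter> L w) = card (L v) - 1"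
  proof -
    have "L v \<inter> L w = L v - {p}" "p \<in> L v" using slide by blast+
    then show ?thesis by simp
  qed
  ultimately show False using label_card V by simp
qed

text \<open>Slides are exactly the parent-child pairs. For comparable nodes this is
  \<open>label_slide_anc\<close>; different branches admit no slide.\<close>

lemma TS_token_graph:
  assumes "card I \<noteq> 0"
  shows "TS (card I) token_graph =
    \<lparr> pverts = L ` V,
      parcs = map_prod L L ` tree_arcs \<rparr>"
proof -
  have sym: "(p, q) \<in> parcs token_graph \<Longrightarrow> (q, p) \<in> parcs token_graph" for p q
    by (auto simp: token_graph_def)
  have adj: "(\<exists>p q. L v - L w = {p} \<and> L w - L v = {q} \<and> (p, q) \<in> parcs token_graph) \<longleftrightarrow>
      w \<noteq> r \<and> v = par w \<or> v \<noteq> r \<and> w = par v" (is "?l \<longleftrightarrow> ?r")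
    if V: "v \<in> V" "w \<in> V" for v w
  proof
    assume ?l
    then obtain p q where pq: "L v - L w = {p}" "L w - L v = {q}" by blast
    from V show ?r
      by (cases rule: anc_or_branch)
        (use label_slide_anc pq no_slide_between_branches in metis)+
  next
    assume ?r
    then show ?l using label_child_slide sym V by metis
  qed
  have "parcs (TS (card I) token_graph) = {(L v, L w) |v w. v \<in> V \<and> w \<in> V \<and>
      (\<exists>p q. L v - L w = {p} \<and> L w - L v = {q} \<and> (p, q) \<in> parcs token_graph)}"
    unfolding TS_def independent_sets_token_graph[OF assms] by auto
  also have "\<dots> = {(L v, L w) |v w. v \<in> V \<and> w \<in> V \<and> (w \<noteq> r \<and> v = par w \<or> v \<noteq> r \<and> w = par v)}"
    by (simp only: adj cong: conj_cong)
  also have "\<dots> = map_prod L L ` tree_arcs"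
  proof -
    have "tree_arcs = {(v, w). v \<in> V \<and> w \<in> V \<and> (w \<noteq> r \<and> v = par w \<or> v \<noteq> r \<and> w = par v)}"
      using par_in by (intro equalityI subsetI) (auto simp: tree_arcs_def)
    moreover have "map_prod L L ` {(v, w). P v w} = {(L v, L w) |v w. P v w}" for P
      by auto
    ultimately show ?thesis by (simp only: conj_assoc)
  qed
  finally show ?thesis
    by (intro pair_pre_digraph.equality) (simp_all add: TS_def independent_sets_token_graph[OF assms])
qed

end

section \<open>Existence of a labelling with prescribed names next to the root\<close>

context parent_tree
begin

text \<open>A single function can index all sibling sets at once because each node has only one
  parent.\<close>

lemma kids_indexing:
  assumes "finite V"
  obtains ix :: "'a \<Rightarrow> nat" where "\<And>v. bij_betw ix (kids v) {1..card (kids v)}"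
proof -
  have "finite (kids v)" for v using assms by (simp add: kids_def)
  then have "\<exists>h. bij_betw h (kids v) {1..card (kids v)}" for v
    by (intro finite_same_card_bij) simp_all
  then obtain h where h: "\<And>v. bij_betw (h v) (kids v) {1..card (kids v)}" by metis
  have "bij_betw (\<lambda>w. h (par w) w) (kids v) {1..card (kids v)}" for v
    using h[of v] by (rule bij_betw_cong[THEN iffD1, rotated]) (simp add: kids_def)
  with that show thesis by blast
qed

text \<open>
  The node \<open>w\<close> carries an enumeration of its label that sends \<open>k + 1\<close> to the token that has just
  arrived. The first \<open>k\<close> tokens may move next, the one with index \<open>i\<close> towards the \<open>i\<close>-th child.
\<close>

lemma labelling_ex:
  fixes a b :: "nat \<Rightarrow> 'v"
  assumes "finite V" and inf: "infinite (UNIV :: 'v set)"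
    and a: "inj_on a {1..k + 1}" and b: "inj_on b {1..k}"
    and ab: "a ` {1..k + 1} \<inter> b ` {1..k} = {}"
    and kids: "\<And>v. v \<in> V \<Longrightarrow> card (kids v) \<le> k"
  obtains L m x ix where "token_tree V r par depth (a ` {1..k + 1}) L m x"
    "bij_betw ix (kids r) {1..card (kids r)}"
    "\<And>w. w \<in> kids r \<Longrightarrow> m w = a (ix w) \<and> x w = b (ix w)"
    "\<And>w. \<lbrakk>w \<in> V; w \<noteq> r; par w \<noteq> r\<rbrakk> \<Longrightarrow> x w \<notin> b ` {1..k}"
proof -
  let ?N = "{1..k + 1}"
  let ?I = "a ` ?N"
  obtain ix where ix: "\<And>v. bij_betw ix (kids v) {1..card (kids v)}"
    using kids_indexing assms(1) by blast
  have ix_in: "ix w \<in> {1..k}" if "w \<in> V" "w \<noteq> r" for w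
  proof -
    have "w \<in> kids (par w)" using that by (simp add: kids_def)
    then have "ix w \<in> {1..card (kids (par w))}" using ix bij_betwE by blast
    then show ?thesis using kids[OF par_in[OF that]] by simp
  qed
  have ix_inj: "v = w"
    if "v \<in> V" "v \<noteq> r" "w \<in> V" "w \<noteq> r" "par v = par w" "ix v = ix w" for v w
  proof -
    have "v \<in> kids (par w)" "w \<in> kids (par w)" using that by (auto simp: kids_def)
    then show ?thesis using ix[of "par w"] that(6) by (auto simp: bij_betw_def dest: inj_onD)
  qed
  \<comment> \<open>A pool with one fresh vertex per node, away from all \<open>a i\<close> and
    \<open>b j\<close>; this is where \<open>'v\<close> has to be infinite.\<close>
  have "infinite (- (?I \<union> b ` {1..k}))" using inf by (simp add: Compl_eq_Diff_UNIV)
  then obtain Y where Y: "Y \<subseteq> - (?I \<union> b ` {1..k})" "finite Y" "card Y = card V"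
    by (meson infinite_arbitrarily_large)
  then obtain y where y: "bij_betw y V Y" using finite_same_card_bij assms(1) by metis
  have y_new: "y v \<notin> ?I" "y v \<notin> b ` {1..k}" if "v \<in> V" for v
    using Y(1) bij_betwE[OF y] that by blast+
  define x where "x v = (if par v = r then b (ix v) else y v)" for v
  have x_inj: "inj_on x (V - {r})"
  proof (rule inj_onI)
    fix v w assume vw: "v \<in> V - {r}" "w \<in> V - {r}" "x v = x w"
    consider "par v = r" "par w = r" | "par v \<noteq> r" "par w \<noteq> r" | "(par v = r) \<noteq> (par w = r)"
      by blast
    then show "v = w"
    proof cases
      case 1
      then have "ix v = ix w"
        using vw ix_in b by (auto simp: x_def dest!: inj_onD)
      with 1 vw show ?thesis using ix_inj by auto
    next
      case 2
      then show ?thesis using vw y by (auto simp: x_def bij_betw_def dest: inj_onD)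
    next
      case 3
      moreover have "b (ix v) \<in> b ` {1..k}" "b (ix w) \<in> b ` {1..k}" using vw ix_in by auto
      ultimately show ?thesis using vw y_new(2)[of v] y_new(2)[of w]
        unfolding x_def by (metis DiffD1)
    qed
  qed
  have x_new: "x w \<notin> ?I" if "w \<in> V" "w \<noteq> r" for w
  proof -
    have "b (ix w) \<in> b ` {1..k}" using ix_in[OF that] by (rule imageI)
    then show ?thesis using y_new(1)[OF that(1)] ab unfolding x_def by auto
  qed

  \<comment> \<open>Recursion along \<open>par\<close>, written as primitive recursion on the depth.
    Slot \<open>ix w\<close> is vacated by the moving token and takes over the previous newcomer
    from slot \<open>k + 1\<close>, which in turn receives \<open>x w\<close>. Thus the newcomer
    never sits in a slot of index at most \<open>k\<close>.\<close>
  define F :: "nat \<Rightarrow> 'a \<Rightarrow> nat \<Rightarrow> 'v" where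
    "F = rec_nat (\<lambda>_. a)
      (\<lambda>_ g w. if w = r then a else (g (par w))(ix w := g (par w) (k + 1), k + 1 := x w))"
  define f where "f v = F (depth v) v" for v
  have f_root: "f r = a"
    unfolding f_def F_def by (cases "depth r") simp_all
  have f_child: "f w = (f (par w))(ix w := f (par w) (k + 1), k + 1 := x w)"
    if "w \<in> V" "w \<noteq> r" for w
    using that by (simp add: f_def F_def depth_par)
  have image_f: "f w ` ?N = insert (x w) (f (par w) ` ?N - {f (par w) (ix w)})"
    if w: "w \<in> V" "w \<noteq> r" and inj: "inj_on (f (par w)) ?N" for w
  proof -
    have "f w ` ?N = insert (x w) (f (par w) ` (?N - {ix w}))"
      using ix_in[OF w] by (auto simp: f_child[OF w] image_iff)
    also have "f (par w) ` (?N - {ix w}) = f (par w) ` ?N - {f (par w) (ix w)}"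
      using inj_on_image_set_diff[OF inj, of ?N "{ix w}"] ix_in[OF w] by auto
    finally show ?thesis .
  qed
  \<comment> \<open>The depth bound is the strengthening that makes \<open>x w\<close> fresh: the
    label of \<open>par w\<close> contains, besides \<open>I\<close>, only vertices
    \<open>x u\<close> with \<open>u\<close> less deep than \<open>w\<close>.\<close>
  have f_inj: "inj_on (f v) ?N \<and> f v ` ?N \<subseteq> ?I \<union> x ` {u \<in> V - {r}. depth u \<le> depth v}"
    if "v \<in> V" for v
    using that
  proof (induction rule: node_induct)
    case root
    show ?case using a by (auto simp: f_root)
  next
    case (child w)
    let ?p = "par w"
    have p: "inj_on (f ?p) ?N" "f ?p ` ?N \<subseteq> ?I \<union> x ` {u \<in> V - {r}. depth u \<le> depth ?p}"
      using child.IH by blast+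
    have d: "depth w = Suc (depth ?p)" using child.hyps depth_par by blast
    have new: "x w \<notin> f ?p ` ?N"
    proof
      assume "x w \<in> f ?p ` ?N"
      then obtain u where "u \<in> V - {r}" "depth u \<le> depth ?p" "x w = x u"
        using p(2) x_new child.hyps by blast
      then show False using inj_onD[OF x_inj, of w u] child.hyps d by auto
    qed
    have "inj_on (f w) ?N"
    proof (rule inj_onI)
      fix i j assume ij: "i \<in> ?N" "j \<in> ?N" "f w i = f w j"
      \<comment> \<open>The slot at the parent from which slot \<open>i\<close> of \<open>w\<close>
        is filled, for \<open>i \<noteq> k + 1\<close>.\<close>
      define \<sigma> where "\<sigma> i = (if i = ix w then k + 1 else i)" for i
      have last: "f w (k + 1) = x w" using f_child[OF child.hyps] by simp
      have val: "f w i = f ?p (\<sigma> i)" if "i \<noteq> k + 1" for i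
        using f_child[OF child.hyps] that by (simp add: \<sigma>_def)
      have \<sigma>: "\<sigma> i \<in> ?N" if "i \<in> ?N" for i using that by (simp add: \<sigma>_def)
      have old: "f ?p (\<sigma> i) \<noteq> x w" if "i \<in> ?N" for i using new \<sigma>[OF that] by (metis imageI)
      consider "i = k + 1" "j = k + 1" | "i = k + 1" "j \<noteq> k + 1" | "i \<noteq> k + 1" "j = k + 1"
        | "i \<noteq> k + 1" "j \<noteq> k + 1" by blast
      then show "i = j"
      proof cases
        case 2
        then show ?thesis using ij(3) val[of j] last old[OF ij(2)] by metis
      next
        case 3
        then show ?thesis using ij(3) val[of i] last old[OF ij(1)] by metis
      next
        case 4
        then have "f ?p (\<sigma> i) = f ?p (\<sigma> j)" using ij(3) val by metis
        then have "\<sigma> i = \<sigma> j" by (rule inj_onD[OF p(1) _ \<sigma>[OF ij(1)] \<sigma>[OF ij(2)]])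
        then show ?thesis using 4 by (simp add: \<sigma>_def split: if_splits)
      qed simp
    qed
    moreover have "f w ` ?N \<subseteq> ?I \<union> x ` {u \<in> V - {r}. depth u \<le> depth w}"
    proof -
      have "f w ` ?N \<subseteq> insert (x w) (f ?p ` ?N)" using image_f child.hyps p(1) by blast
      also have "\<dots> \<subseteq> ?I \<union> x ` {u \<in> V - {r}. depth u \<le> depth w}"
        using p(2) child.hyps d by fastforce
      finally show ?thesis .
    qed
    ultimately show ?case by blast
  qed

  define L where "L v = f v ` ?N" for v
  define m where "m w = f (par w) (ix w)" for w
  have "token_tree V r par depth ?I L m x"
  proof unfold_locales
    show "L r = ?I" by (simp add: L_def f_root)
    show "L w = insert (x w) (L (par w) - {m w})" if "w \<in> V" "w \<noteq> r" for w
      unfolding L_def m_def using image_f that f_inj par_in by blast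
    show "m w \<in> L (par w)" if "w \<in> V" "w \<noteq> r" for w
      unfolding L_def m_def using ix_in[OF that] by auto
    \<comment> \<open>The moving token is in slot \<open>ix w \<le> k\<close>, the newcomer in slot
      \<open>k + 1\<close>.\<close>
    show "m w \<noteq> x (par w)" if w: "w \<in> V" "w \<noteq> r" "par w \<noteq> r" for w
    proof -
      have "x (par w) = f (par w) (k + 1)" using f_child[of "par w"] w par_in by simp
      moreover have "inj_on (f (par w)) ?N" using f_inj par_in w by blast
      ultimately show ?thesis
        using ix_in[OF w(1,2)] inj_onD[of "f (par w)" ?N "ix w" "k + 1"] by (auto simp: m_def)
    qed
    show "v = w" if "v \<in> V" "v \<noteq> r" "w \<in> V" "w \<noteq> r" "par v = par w" "m v = m w" for v w
    proof -
      have "inj_on (f (par w)) ?N" using f_inj par_in that by blast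
      then have "ix v = ix w"
        using that ix_in[of v] ix_in[of w] inj_onD[of "f (par w)" ?N "ix v" "ix w"] by (simp add: m_def)
      then show ?thesis using ix_inj that by blast
    qed
  qed (use assms(1) x_inj x_new in auto)
  moreover have "m w = a (ix w) \<and> x w = b (ix w)" if "w \<in> kids r" for w
    using that f_root by (simp add: kids_def m_def x_def)
  moreover have "x w \<notin> b ` {1..k}" if "w \<in> V" "par w \<noteq> r" for w
    using that y_new by (simp add: x_def)
  ultimately show thesis using that ix[of r] by blast
qed

end

section \<open>Rooting an undirected tree\<close>

lemma children_root:
  assumes "pair_graph T" "r \<in> pverts T"
  shows "children T r r = {w. (r, w) \<in> parcs T}"
proof -
  interpret pair_graph T by fact
  show ?thesis
  proof (intro equalityI subsetI)
    fix w assume "w \<in> children T r r"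
    then obtain p where "apath r (p @ [(r, w)]) w" by (auto simp: children_def)
    then show "w \<in> {w. (r, w) \<in> parcs T}"
      by (auto simp: apath_def)
  next
    fix w assume "w \<in> {w. (r, w) \<in> parcs T}"
    then have "apath r ([] @ [(r, w)]) w"
      using assms(2) no_loops' in_arcsD2 by (auto simp: apath_simps)
    then show "w \<in> children T r r" unfolding children_def by blast
  qed
qed

lemma finite_children:
  assumes "pair_graph T"
  shows "finite (children T r v)"
proof -
  interpret pair_graph T by fact
  have "children T r v \<subseteq> pverts T"
    by (auto simp: children_def apath_def dest: awalk_last_in_verts)
  then show ?thesis using pair_finite_verts finite_subset by blast
qed

text \<open>Breadth-first search: \<open>depth\<close> is the distance from \<open>r\<close>, and
  \<open>par v\<close> is the last vertex before \<open>v\<close> on a shortest walk.\<close>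

lemma parent_function_ex:
  assumes graph: "pair_graph T" and conn: "Digraph_Component.connected (with_proj T)"
    and r: "r \<in> pverts T"
  obtains par depth where "parent_tree (pverts T) r par depth"
    "\<And>v. \<lbrakk>v \<in> pverts T; v \<noteq> r\<rbrakk> \<Longrightarrow> (par v, v) \<in> parcs T"
proof -
  interpret pair_graph T by fact
  define depth where "depth v = (LEAST n. \<exists>p. awalk r p v \<and> length p = n)" for v
  have depth_le: "depth v \<le> length p" if "awalk r p v" for p v
    unfolding depth_def using that by (intro Least_le) blast
  have shortest: "\<exists>p. awalk r p v \<and> length p = depth v" if "v \<in> pverts T" for v
  proof -
    have "strongly_connected (with_proj T)"
      using symmetric_connected_imp_strongly_connected conn sym_arcs by blast
    then have "\<exists>p. awalk r p v"
      using r that by (auto simp: strongly_connected_def reachable_awalk)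
    then show ?thesis
      using LeastI_ex[of "\<lambda>n. \<exists>p. awalk r p v \<and> length p = n"] unfolding depth_def by blast
  qed
  have "\<exists>u. (u, v) \<in> parcs T \<and> depth v = Suc (depth u)" if v: "v \<in> pverts T" "v \<noteq> r" for v
  proof -
    obtain p where p: "awalk r p v" "length p = depth v" using shortest v by blast
    with v(2) have "p \<noteq> []" by (auto simp: awalk_Nil_iff)
    then obtain q u w where q: "p = q @ [(u, w)]" by (metis prod.exhaust rev_exhaust)
    with p(1) have walk: "awalk r q u" "(u, v) \<in> parcs T" "w = v"
      by (auto simp: awalk_simps)
    \<comment> \<open>A shortest walk to \<open>u\<close>, extended by the last arc, bounds
      \<open>depth v\<close> from above; the prefix \<open>q\<close> gives the reverse
      bound.\<close>
    obtain q' where q': "awalk r q' u" "length q' = depth u"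
      using shortest walk(2) in_arcsD1 by blast
    then have "awalk r (q' @ [(u, v)]) v"
      using walk(2) v(1) by (auto simp: awalk_simps)
    then have "depth v \<le> Suc (depth u)" using depth_le[of "q' @ [(u, v)]" v] q'(2) by simp
    moreover have "Suc (depth u) \<le> depth v" using depth_le[OF walk(1)] p(2) q by simp
    ultimately show ?thesis using walk(2) by auto
  qed
  then have "\<forall>v. \<exists>u. v \<in> pverts T \<and> v \<noteq> r \<longrightarrow> (u, v) \<in> parcs T \<and> depth v = Suc (depth u)"
    by blast
  then obtain par where par: "\<And>v. v \<in> pverts T \<and> v \<noteq> r \<longrightarrow> (par v, v) \<in> parcs T \<and> depth v = Suc (depth (par v))"
    by metis
  then have "parent_tree (pverts T) r par depth"
    by unfold_locales (use r in_arcsD1 in blast)+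
  with par show thesis using that by blast
qed

locale rooted_graph = parent_tree "pverts T" r par depth + pair_graph T
  for T :: "'a pair_pre_digraph" and r par depth +
  assumes par_arc: "\<lbrakk>v \<in> pverts T; v \<noteq> r\<rbrakk> \<Longrightarrow> (par v, v) \<in> parcs T"
begin

lemma tree_arcs_subset: "tree_arcs \<subseteq> parcs T"
proof
  fix e assume "e \<in> tree_arcs"
  then obtain w where "w \<in> pverts T - {r}" "e = (par w, w) \<or> e = (w, par w)"
    by (auto simp: tree_arcs_def)
  then show "e \<in> parcs T"
    using par_arc[of w] arcs_symmetric[of "par w" w] by auto
qed

text \<open>The depth bound is carried through the induction so that \<open>w\<close> is not on the
  path to \<open>par w\<close>, which can then be extended.\<close>

lemma path_from_root:
  assumes "w \<in> pverts T"
  shows "\<exists>p. apath r p w \<and> set p \<subseteq> tree_arcs \<and> (\<forall>z\<in>set (awalk_verts r p). depth z \<le> depth w)"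
  using assms
proof (induction rule: node_induct)
  case root
  show ?case by (rule exI[of _ "[]"]) (simp add: apath_Nil_iff root_in)
next
  case (child w)
  then obtain p where p: "apath r p (par w)" "set p \<subseteq> tree_arcs"
    "\<And>z. z \<in> set (awalk_verts r p) \<Longrightarrow> depth z \<le> depth (par w)" by blast
  have d: "depth w = Suc (depth (par w))" using child depth_par by blast
  have walk: "awalk r p (par w)" using p(1) by (simp add: apath_def)
  have "w \<notin> set (awalk_verts r p)" using p(3)[of w] d by auto
  then have path: "apath r (p @ [(par w, w)]) w"
    using p(1) walk child.hyps par_arc no_loops'[of "par w" w]
    by (simp add: apath_append_iff apath_simps)
  moreover have "set (p @ [(par w, w)]) \<subseteq> tree_arcs"
    using p(2) child.hyps by (auto simp: tree_arcs_def)
  moreover have "\<forall>z\<in>set (awalk_verts r (p @ [(par w, w)])). depth z \<le> depth w"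
    using p(3) d awalk_verts_append[OF awalkI_apath[OF path]] walk by (auto intro: le_SucI)
  ultimately show ?case using path by blast
qed

text \<open>Passes the bound \<open>k\<close> from the path-based \<open>children\<close> to the
  parent-based \<open>kids\<close>.\<close>

lemma kids_subset_children:
  "kids v \<subseteq> children T r v"
proof
  fix w assume "w \<in> kids v"
  then have w: "w \<in> pverts T" "w \<noteq> r" "par w = v" by (auto simp: kids_def)
  then obtain p where p: "apath r p v"
    "\<And>z. z \<in> set (awalk_verts r p) \<Longrightarrow> depth z \<le> depth v"
    using path_from_root par_in by metis
  have "w \<notin> set (awalk_verts r p)" using p(2)[of w] depth_par[of w] w by auto
  moreover have "awalk r p v" using p(1) by (simp add: apath_def)
  ultimately have "apath r (p @ [(v, w)]) w"
    using p(1) w par_arc[of w] no_loops'[of v w] by (simp add: apath_append_iff apath_simps)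
  then show "w \<in> children T r v" by (auto simp: children_def)
qed

text \<open>An arc outside the spanning tree would close a cycle.\<close>

lemma tree_arcs_eq:
  assumes "\<not> (\<exists>p. cycle p \<and> 3 \<le> length p)"
  shows "parcs T = tree_arcs"
proof (intro equalityI tree_arcs_subset subsetI)
  fix e assume "e \<in> parcs T"
  then obtain u v where e: "e = (u, v)" "(u, v) \<in> parcs T" by (cases e) auto
  then have uv: "u \<in> pverts T" "v \<in> pverts T" "u \<noteq> v"
    using in_arcsD1 in_arcsD2 no_loops' by blast+
  obtain p where p: "awalk r p u" "set p \<subseteq> tree_arcs"
    using path_from_root[OF uv(1)] awalkI_apath by blast
  obtain q where q: "awalk r q v" "set q \<subseteq> tree_arcs"
    using path_from_root[OF uv(2)] awalkI_apath by blast
  have rev: "set (rev_path p) \<subseteq> tree_arcs"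
    using p(2) by (induction p) (auto simp: tree_arcs_def)
  \<comment> \<open>The walk from \<open>u\<close> up to \<open>r\<close> and down to
    \<open>v\<close> stays in the tree and is shortened to a path. Closed up by the arc
    \<open>(v, u)\<close> it is a cycle, so without cycles of length at least 3 it must be the
    single arc \<open>(u, v)\<close>.\<close>
  define s where "s = awalk_to_apath (rev_path p @ q)"
  have "awalk u (rev_path p) r" using p(1) by simp
  then have walk: "awalk u (rev_path p @ q) v" using q(1) by (rule awalk_appendI)
  have s: "apath u s v" "set s \<subseteq> tree_arcs"
    using apath_awalk_to_apath[OF walk] awalk_to_apath_subset[OF walk] rev q(2)
    unfolding s_def by auto
  then have walk: "awalk u s v" and dist: "distinct (awalk_verts u s)" by (auto simp: apath_def)
  have "cycle ((v, u) # s)"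
    unfolding cycle_def using walk dist e(2) arcs_symmetric by (auto simp: awalk_simps)
  with assms have "length s < 2" by fastforce
  moreover have "s \<noteq> []" using walk uv(3) by (auto simp: awalk_simps)
  ultimately obtain a where "s = [a]" by (cases s) (auto simp: Suc_le_eq)
  with walk have "s = [(u, v)]" by (cases a) (auto simp: awalk_simps)
  with s(2) e(1) show "e \<in> tree_arcs" by simp
qed

end

section \<open>Transport along isomorphisms\<close>

lemma pair_graph_TS:
  assumes "pair_graph G"
  shows "pair_graph (TS m G)"
proof -
  interpret pair_graph G by fact
  have "pverts (TS m G) \<subseteq> Pow (pverts G)"
    by (auto simp: TS_def independent_sets_of_size_def independent_set_def)
  then have fin: "finite (pverts (TS m G))"
    using pair_finite_verts by (meson finite_Pow_iff finite_subset)
  have "parcs (TS m G) \<subseteq> pverts (TS m G) \<times> pverts (TS m G)"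
    by (auto simp: TS_def)
  with fin have "finite (parcs (TS m G))"
    by (meson finite_SigmaI finite_subset)
  moreover have "symmetric (with_proj (TS m G))"
    unfolding symmetric_def using arcs_symmetric by (auto simp: TS_def intro!: symI)
  moreover have "I \<in> pverts (TS m G) \<and> J \<in> pverts (TS m G) \<and> I \<noteq> J"
    if "(I, J) \<in> parcs (TS m G)" for I J
  proof -
    from that have "I - J \<noteq> {}" by (auto simp: TS_def)
    with that show ?thesis by (auto simp: TS_def)
  qed
  ultimately show ?thesis
  proof (unfold_locales, goal_cases)
    case (1 e) then show ?case by (cases e) auto
  next
    case (2 e) then show ?case by (cases e) auto
  next
    case (3) then show ?case using fin by simp
  next
    case (4) then show ?case by simp
  next
    case (5 e) then show ?case by (cases e) auto
  next
    case (6) then show ?case by simp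
  qed
qed

lemma rooted_isomorphic_sym:
  assumes "pair_wf_digraph T" "rooted_isomorphic T r T' r'" "r \<in> pverts T"
  shows "rooted_isomorphic T' r' T r"
proof -
  interpret pair_wf_digraph T by fact
  obtain h where h: "digraph_isomorphism h" "with_proj T' = app_iso h (with_proj T)"
    "iso_verts h r = r'"
    using assms(2) by (auto simp: rooted_isomorphic_def)
  have "pre_digraph.digraph_isomorphism (with_proj T') (inv_iso h)"
    using digraph_isomorphism_invI[OF h(1)] h(2) by simp
  moreover have "with_proj T = app_iso (inv_iso h) (with_proj T')"
    using h(2) app_iso_inv[OF h(1)] by simp
  moreover have "iso_verts (inv_iso h) r' = r"
    using h(1,3) assms(3) iso_verts_inv_iso by fastforce
  ultimately show ?thesis unfolding rooted_isomorphic_def by blast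
qed

lemma apath_app_isoI:
  assumes "wf_digraph G" "pre_digraph.digraph_isomorphism G h" "pre_digraph.apath G u p v"
  shows "pre_digraph.apath (app_iso h G) (iso_verts h u) (map (iso_arcs h) p) (iso_verts h v)"
proof -
  interpret wf_digraph G by fact
  have p: "awalk u p v" "distinct (awalk_verts u p)" using assms(3) by (auto simp: apath_def)
  have "inj_on (iso_verts h) (set (awalk_verts u p))"
    using digraph_isomorphism_inj_on_verts[OF assms(2)] awalk_verts_in_verts p(1)
    unfolding awalk_def by (meson inj_on_subset subsetI)
  with p show ?thesis
    using awalk_app_isoI[OF p(1) assms(2)] awalk_verts_app_iso_eq[OF assms(2) p(1)]
    by (simp add: pre_digraph.apath_def distinct_map)
qed

lemma cycle_app_isoI:
  assumes "wf_digraph G" "pre_digraph.digraph_isomorphism G h" "pre_digraph.cycle G p"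
  shows "pre_digraph.cycle (app_iso h G) (map (iso_arcs h) p)"
proof -
  interpret wf_digraph G by fact
  obtain u where p: "awalk u p u" "distinct (tl (awalk_verts u p))" "p \<noteq> []"
    using assms(3) by (auto simp: cycle_def)
  have "set (tl (awalk_verts u p)) \<subseteq> verts G"
    using p(1) awalk_verts_in_verts list.set_sel(2)[OF awalk_verts_non_Nil]
    unfolding awalk_def by blast
  then have "inj_on (iso_verts h) (set (tl (awalk_verts u p)))"
    using digraph_isomorphism_inj_on_verts[OF assms(2)] inj_on_subset by blast
  with p show ?thesis
    using awalk_app_isoI[OF p(1) assms(2)] awalk_verts_app_iso_eq[OF assms(2) p(1)]
    by (auto simp: pre_digraph.cycle_def distinct_map map_tl[symmetric])
qed

text \<open>Connectedness is carried forward along \<open>h\<close>. Cycles and paths to children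
  are pulled back along the inverse \<open>g\<close>, so \<open>T'\<close> inherits their bounds
  from \<open>T\<close>.\<close>

lemma kary_tree_isomorphic:
  assumes tree: "kary_tree k T r" and iso: "rooted_isomorphic T r T' r'" and graph: "pair_graph T'"
  shows "kary_tree k T' r'"
proof -
  have T: "pair_graph T" "Digraph_Component.connected (with_proj T)" "r \<in> pverts T"
    "\<not> (\<exists>p. pre_digraph.cycle (with_proj T) p \<and> 3 \<le> length p)"
    "\<And>v. v \<in> pverts T \<Longrightarrow> card (children T r v) \<le> k"
    using tree by (auto simp: kary_tree_def undirected_tree_def)
  interpret T: pair_graph T by fact
  interpret T': pair_graph T' by fact
  obtain h where h: "T.digraph_isomorphism h" "with_proj T' = app_iso h (with_proj T)"
    "iso_verts h r = r'"
    using iso by (auto simp: rooted_isomorphic_def)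
  obtain g where g: "T'.digraph_isomorphism g" "with_proj T = app_iso g (with_proj T')"
    "iso_verts g r' = r"
    using rooted_isomorphic_sym[OF T.pair_wf_digraph iso T(3)] by (auto simp: rooted_isomorphic_def)
  have verts: "pverts T = iso_verts g ` pverts T'" "pverts T' = iso_verts h ` pverts T"
    using g(2) h(2) by (metis app_iso_simps(1) with_proj_simps(1))+
  \<comment> \<open>Arcs of both graphs are pairs with projections as tail and head, so the arc map
    is determined by the vertex map.\<close>
  have arc: "iso_arcs g e = (iso_verts g (fst e), iso_verts g (snd e))" if "e \<in> parcs T'" for e
  proof -
    have "iso_tail g = fst" "iso_head g = snd"
      using g(2) by (metis app_iso_simps(3,4) with_proj_simps(4,5))+
    then show ?thesis using T'.iso_verts_tail[OF g(1) that] T'.iso_verts_head[OF g(1) that]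
      by (metis prod.collapse)
  qed
  have "Digraph_Component.connected (with_proj T')"
    using T.connectedI_app_iso[OF T(2) h(1)] h(2) by simp
  moreover have "\<not> (\<exists>p. T'.cycle p \<and> 3 \<le> length p)"
    using cycle_app_isoI[OF T'.wf_digraph_axioms g(1)] g(2) T(4) by (metis length_map)
  moreover have "card (children T' r' v) \<le> k" if v: "v \<in> pverts T'" for v
  proof -
    have sub: "iso_verts g ` children T' r' v \<subseteq> children T r (iso_verts g v)"
    proof
      fix w assume "w \<in> iso_verts g ` children T' r' v"
      then obtain w' p where w: "w = iso_verts g w'" "T'.apath r' (p @ [(v, w')]) w'"
        by (auto simp: children_def)
      then have "(v, w') \<in> parcs T'" by (auto simp: T'.apath_def T'.awalk_def)
      then have "T.apath r (map (iso_arcs g) p @ [(iso_verts g v, w)]) w"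
        using apath_app_isoI[OF T'.wf_digraph_axioms g(1) w(2)] g(2,3) arc w(1) by simp
      then show "w \<in> children T r (iso_verts g v)" by (auto simp: children_def)
    qed
    have "children T' r' v \<subseteq> pverts T'"
      by (auto simp: children_def T'.apath_def dest: T'.awalk_last_in_verts)
    then have "inj_on (iso_verts g) (children T' r' v)"
      using T'.digraph_isomorphism_inj_on_verts[OF g(1)] inj_on_subset by blast
    then have "card (children T' r' v) = card (iso_verts g ` children T' r' v)"
      by (simp add: card_image)
    also have "\<dots> \<le> card (children T r (iso_verts g v))"
      using sub finite_children[OF T(1)] by (rule card_mono[rotated])
    also have "\<dots> \<le> k" using T(5) verts(1) v by blast
    finally show ?thesis .
  qed
  ultimately show ?thesis
    using graph h(3) T(3) verts(2) by (auto simp: kary_tree_def undirected_tree_def)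
qed

section \<open>Assembling the canonically labelled graph\<close>

theorem proposition19:
  fixes k :: nat
    and a b :: "nat \<Rightarrow> 'v"
    and T :: "'a pair_pre_digraph"
    and r :: 'a
  assumes "infinite (UNIV :: 'v set)"
    and "k \<ge> 2"
    and "inj_on a {1..k + 1}" and "inj_on b {1..k}"
    and "a ` {1..k + 1} \<inter> b ` {1..k} = {}"
    and "kary_tree k T r"
  shows "\<exists>G :: 'v pair_pre_digraph. canonically_labelled k a b G \<and>
           rooted_isomorphic T r (TS (k + 1) G) (a ` {1..k + 1})"
proof -
  have T: "pair_graph T" "Digraph_Component.connected (with_proj T)" "r \<in> pverts T"
    "\<not> (\<exists>p. pre_digraph.cycle (with_proj T) p \<and> 3 \<le> length p)"
    and kary: "\<And>v. v \<in> pverts T \<Longrightarrow> card (children T r v) \<le> k"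
    using assms(6) by (auto simp: kary_tree_def undirected_tree_def)
  obtain par depth where par: "parent_tree (pverts T) r par depth"
    "\<And>v. \<lbrakk>v \<in> pverts T; v \<noteq> r\<rbrakk> \<Longrightarrow> (par v, v) \<in> parcs T"
    using parent_function_ex[OF T(1-3)] by blast
  interpret rooted_graph T r par depth
    unfolding rooted_graph_def rooted_graph_axioms_def using par T(1) by blast
  have arcs: "parcs T = tree_arcs" using tree_arcs_eq T(4) by blast
  have kids_k: "card (kids v) \<le> k" if "v \<in> pverts T" for v
  proof -
    have "card (kids v) \<le> card (children T r v)"
      using kids_subset_children finite_children[OF T(1)] by (metis card_mono)
    with kary[OF that] show ?thesis by simp
  qed
  let ?I = "a ` {1..k + 1}"
  obtain L m x ix where lab: "token_tree (pverts T) r par depth ?I L m x"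
    and ix: "bij_betw ix (kids r) {1..card (kids r)}"
    and first: "\<And>w. w \<in> kids r \<Longrightarrow> m w = a (ix w) \<and> x w = b (ix w)"
    and later: "\<And>w. \<lbrakk>w \<in> pverts T; w \<noteq> r; par w \<noteq> r\<rbrakk> \<Longrightarrow> x w \<notin> b ` {1..k}"
    using labelling_ex[OF pair_finite_verts assms(1,3,4,5) kids_k] by blast
  interpret L: token_tree "pverts T" r par depth ?I L m x by (fact lab)
  let ?G = "L.token_graph"
  let ?S = "TS (k + 1) ?G"
  have cardI: "card ?I = k + 1" using assms(3) by (simp add: card_image)
  then have S: "?S = \<lparr> pverts = L ` pverts T, parcs = map_prod L L ` parcs T \<rparr>"
    using L.TS_token_graph unfolding arcs by simp
  have iso: "rooted_isomorphic T r ?S ?I"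
  proof -
    \<comment> \<open>With \<open>fst\<close> and \<open>snd\<close> as tail and head the image is
      again a graph on pairs, and arcs are mapped endpoint by endpoint.\<close>
    let ?h = "\<lparr> iso_verts = L, iso_arcs = map_prod L L, iso_head = snd, iso_tail = fst \<rparr>"
    have "parcs T \<subseteq> pverts T \<times> pverts T" using in_arcsD1 in_arcsD2 by auto
    then have "inj_on (map_prod L L) (parcs T)"
      using map_prod_inj_on[OF L.label_inj L.label_inj] inj_on_subset by blast
    then have "digraph_isomorphism ?h"
      using L.label_inj wf_digraph_axioms by (simp add: digraph_isomorphism_def)
    moreover have "with_proj ?S = app_iso ?h (with_proj T)"
      unfolding S by (simp add: with_proj_def app_iso_def)
    ultimately show ?thesis
      unfolding rooted_isomorphic_def using L.label_root by force
  qed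
  have G: "pair_graph ?G" by (rule L.pair_graph_token_graph)
  have tree: "kary_tree k ?S ?I"
    using kary_tree_isomorphic[OF assms(6) iso pair_graph_TS[OF G]] .
  have L_root: "L v = ?I \<longleftrightarrow> v = r" if "v \<in> pverts T" for v
    using that L.label_inj L.label_root root_in by (metis inj_onD)
  have kids_arcs: "kids r = {w. (r, w) \<in> parcs T}"
    unfolding arcs by (auto simp: kids_def tree_arcs_def)
  have children_S: "children ?S ?I ?I = L ` kids r"
  proof -
    have "?I \<in> pverts ?S" using S L.label_root root_in by auto
    then have "children ?S ?I ?I = {W. (?I, W) \<in> parcs ?S}"
      using children_root[OF pair_graph_TS[OF G]] by simp
    also have "\<dots> = L ` {w. (r, w) \<in> parcs T}"
    proof (intro equalityI subsetI)
      fix W assume "W \<in> {W. (?I, W) \<in> parcs ?S}"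
      then obtain v w where "(v, w) \<in> parcs T" "L v = ?I" "W = L w" unfolding S by auto
      then show "W \<in> L ` {w. (r, w) \<in> parcs T}" using L_root in_arcsD1 by auto
    next
      fix W assume "W \<in> L ` {w. (r, w) \<in> parcs T}"
      then obtain w where "(r, w) \<in> parcs T" "W = L w" by blast
      then show "W \<in> {W. (?I, W) \<in> parcs ?S}"
        unfolding S using imageI[of "(r, w)" "parcs T" "map_prod L L"] L.label_root by simp
    qed
    finally show ?thesis by (simp add: kids_arcs)
  qed
  \<comment> \<open>The number \<open>d\<close> of condition (b) is \<open>card (kids r)\<close>;
    \<open>ix\<close> numbers the children of the root.\<close>
  have "children ?S ?I ?I = (\<lambda>i. (?I - {a i}) \<union> {b i}) ` {1..card (kids r)}"
  proof -
    have "L w = (?I - {a (ix w)}) \<union> {b (ix w)}" if "w \<in> kids r" for w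
      using that first[OF that] L.label_child[of w] L.label_root by (simp add: kids_def)
    then have "L ` kids r = (\<lambda>i. (?I - {a i}) \<union> {b i}) ` ix ` kids r"
      by (simp add: image_image)
    then show ?thesis using children_S ix by (simp add: bij_betw_imp_surj_on)
  qed
  \<comment> \<open>A vertex \<open>b j\<close> on a label would be some \<open>x w\<close>. Deeper
    nodes avoid all \<open>b\<close> labels, so \<open>w\<close> is a child of the root with index
    \<open>j\<close>, but these indices stop at \<open>card (kids r)\<close>.\<close>
  moreover have "b j \<notin> pverts ?G" if j: "j \<in> {card (kids r) + 1..k}" for j
  proof
    assume "b j \<in> pverts ?G"
    then have "b j \<in> ?I \<union> x ` (pverts T - {r})"
      using L.label_union by (auto simp: L.token_graph_def)
    moreover have "b j \<in> b ` {1..k}" using j by auto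
    ultimately obtain w where w: "w \<in> pverts T" "w \<noteq> r" "b j = x w"
      using assms(5) by blast
    with later \<open>b j \<in> b ` {1..k}\<close> have "w \<in> kids r" by (auto simp: kids_def)
    then have "ix w \<in> {1..card (kids r)}" "b j = b (ix w)"
      using ix first w(3) by (auto dest: bij_betwE)
    moreover from this have "j = ix w"
      using j kids_k[OF T(3)] inj_onD[OF assms(4)] by simp
    ultimately show False using j by simp
  qed
  moreover have "card (?I \<inter> W) \<le> k - 1"
    if W: "W \<in> pverts ?S" "W \<noteq> ?I" "W \<notin> children ?S ?I ?I" for W
  proof -
    obtain v where v: "v \<in> pverts T" "W = L v" using W(1) unfolding S by auto
    have "v \<noteq> r" using v W(2) L.label_root by blast
    then have "par v \<noteq> r" using v W(3) children_S by (auto simp: kids_def)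
    \<comment> \<open>A node at least two steps from the root has lost two vertices of
      \<open>?I\<close>, leaving at most \<open>(k + 1) - 2 = k - 1\<close>.\<close>
    then obtain p q where pq: "p \<noteq> q" "p \<in> L r - L v" "q \<in> L r - L v"
      using L.two_tokens_moved[OF anc_root[OF v(1)]] \<open>v \<noteq> r\<close> by metis
    then have "?I \<inter> W \<subseteq> ?I - {p, q}" "{p, q} \<subseteq> ?I" using v(2) L.label_root by auto
    then have "card (?I \<inter> W) \<le> card ?I - card {p, q}"
      by (metis card_Diff_subset card_mono finite.emptyI finite.insertI finite_Diff finite_atLeastAtMost finite_imageI)
    then show ?thesis using cardI pq(1) by simp
  qed
  ultimately have "canonically_labelled k a b ?G"
    unfolding canonically_labelled_def Let_def using G tree kids_k[OF T(3)] by blast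
  with iso show ?thesis by blast
qed

end
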